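(* Let $A=\Bbbk(\omega,N)$ be endowed with a bilinear form $\langle-,-\rangle$ given by $\langle e_sx^m,e_tx^n\rangle=d_{(s,m)}\delta_{\mu(s),t}\delta_{\nu(m),n}$ for $s,t\in S$, $0\le m,n\le N-1$, where $\mu$ is a permutation of $S$, $\nu$ is a permutation of $\{0,1,\dots,N-1\}$ and $d_{(s,m)}\in\Bbbk\setminus\{0\}$ for all $s,m$. Let $s\in S$ and let $m$ be an integer with $0\le m\le N-1$. Then $$N_{s,0}^{\perp_R}=N_{\mu^2(s),0}^{\perp_L}=\bigoplus_{t\in S,\ t\ne\mu(s)}N_{t,0}.$$ Assume moreover that $\nu(k)=N-1-k$ for all $0\le k\le N-1$. Then $$N_{s,m}^{\perp_R}=N_{\mu^2(s),m}^{\perp_L}\qquad\text{and}\qquad N_{s,m}^{\perp_R}=N_{s,0}^{\perp_R}\oplus N_{\mu(s),N-m}.$$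
   Context: $\Bbbk$ is a field. Let $N\ge 2$ be an integer, $S$ a finite set of cardinality at least $N$, and $\omega$ a permutation of $S$. $\Bbbk(\omega,N)$ denotes the (unital associative) $\Bbbk$-algebra generated by $\{e_s, x\mid s\in S\}$ with relations, for all $s,t\in S$, $$e_se_t=\delta_{s,t}e_t,\qquad 1=\sum_{s\in S}e_s,\qquad x^N=0,\qquad e_sx=xe_{\omega(s)}.$$ It has $\Bbbk$-basis $\{e_sx^n\mid 0\le n\le N-1,\ s\in S\}$. $R$ is the subalgebra generated by $x$, and $N_{s,t}:=e_sx^tR$ for $s\in S$ and $0\le t\le N$ (so $N_{s,N}=0$). For a subspace $W\subseteq A$, $W^{\perp_L}:=\{v\in A\mid\langle v,w\rangle=0\ \forall w\in W\}$ and $W^{\perp_R}:=\{v\in A\mid\langle w,v\rangle=0\ \forall w\in W\}$. *)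

theory Defs
  imports "HOL-Library.Poly_Mapping" "HOL-Algebra.Algebra"
    "HOL-Algebra.Algebraic_Closure_Type"
begin

text \<open>
  The free monoid on \<open>'g\<close>. Lists carry no \<^class>\<open>monoid_add\<close> structure, hence the copy;
  addition is concatenation. With it, the type of finitely supported functions
  \<open>'g word \<Rightarrow>\<^sub>0 'k\<close> with its convolution product is the free unital associative
  algebra on the generators \<open>'g\<close>.
\<close>

datatype 'g word = Word (letters: "'g list")

instantiation word :: (type) monoid_add
begin

definition zero_word :: "'g word" where "zero_word = Word []"

definition plus_word :: "'g word \<Rightarrow> 'g word \<Rightarrow> 'g word"
  where "plus_word u v = Word (letters u @ letters v)"

instance by standard (simp_all add: zero_word_def plus_word_def)

end

definition var :: "'g \<Rightarrow> 'g word \<Rightarrow>\<^sub>0 'k::comm_ring_1"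
  where "var g = Poly_Mapping.single (Word [g]) 1"

definition const :: "'k \<Rightarrow> 'g word \<Rightarrow>\<^sub>0 'k::comm_ring_1"
  where "const c = Poly_Mapping.single 0 c"

definition scalars :: "'k::comm_ring_1 ring"
  where "scalars = ring_of_type_algebra"

definition free_algebra :: "('g word \<Rightarrow>\<^sub>0 'k::comm_ring_1) ring"
  where "free_algebra = ring_of_type_algebra"

definition relation_ideal :: "('g word \<Rightarrow>\<^sub>0 'k::comm_ring_1) set \<Rightarrow> ('g word \<Rightarrow>\<^sub>0 'k) set"
  where "relation_ideal rels = Idl\<^bsub>free_algebra\<^esub> rels"

definition residue_class ::
    "('g word \<Rightarrow>\<^sub>0 'k::comm_ring_1) set \<Rightarrow> ('g word \<Rightarrow>\<^sub>0 'k) \<Rightarrow> ('g word \<Rightarrow>\<^sub>0 'k) set"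
  where "residue_class rels p = relation_ideal rels +>\<^bsub>free_algebra\<^esub> p"

text \<open>
  The quotient of the free algebra by the two-sided ideal generated by \<open>rels\<close>
  (each element of \<open>rels\<close> being set to zero), with its scalar multiplication.
\<close>

definition presented_algebra ::
    "('g word \<Rightarrow>\<^sub>0 'k::comm_ring_1) set \<Rightarrow> ('k, ('g word \<Rightarrow>\<^sub>0 'k) set) module"
  where "presented_algebra rels =
    (let Q = free_algebra Quot relation_ideal rels
     in ring.extend Q (module.fields (\<lambda>c Y. residue_class rels (const c) \<otimes>\<^bsub>Q\<^esub> Y)))"

lemma free_algebra_simps:
  "carrier free_algebra = UNIV" "p \<otimes>\<^bsub>free_algebra\<^esub> q = p * q" "p \<oplus>\<^bsub>free_algebra\<^esub> q = p + q"
  "\<one>\<^bsub>free_algebra\<^esub> = 1" "\<zero>\<^bsub>free_algebra\<^esub> = 0"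
  by (simp_all add: free_algebra_def ring_of_type_algebra_def)

lemma ring_free_algebra: "ring free_algebra"
proof (rule ringI)
  show "abelian_group (free_algebra :: ('g word \<Rightarrow>\<^sub>0 'k::comm_ring_1) ring)"
    by (rule abelian_groupI) (auto simp: free_algebra_simps add.assoc add.commute intro: exI[of _ "- _"] left_minus)
  show "monoid (free_algebra :: ('g word \<Rightarrow>\<^sub>0 'k::comm_ring_1) ring)"
    by (rule monoidI) (auto simp: free_algebra_simps mult.assoc)
qed (auto simp: free_algebra_simps distrib_left distrib_right)

lemma ideal_relation_ideal: "ideal (relation_ideal rels) free_algebra"
  unfolding relation_ideal_def
  by (rule ring.genideal_ideal[OF ring_free_algebra]) (simp add: free_algebra_simps)

lemma presented_algebra_simps:
  fixes rels :: "('g word \<Rightarrow>\<^sub>0 'k::comm_ring_1) set"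
  shows "carrier (presented_algebra rels) = range (residue_class rels)"
    and "residue_class rels p \<otimes>\<^bsub>presented_algebra rels\<^esub> residue_class rels q = residue_class rels (p * q)"
    and "residue_class rels p \<oplus>\<^bsub>presented_algebra rels\<^esub> residue_class rels q = residue_class rels (p + q)"
    and "\<one>\<^bsub>presented_algebra rels\<^esub> = residue_class rels 1"
    and "\<zero>\<^bsub>presented_algebra rels\<^esub> = residue_class rels 0"
    and "c \<odot>\<^bsub>presented_algebra rels\<^esub> residue_class rels p = residue_class rels (const c * p)"
proof -
  interpret I: ideal "relation_ideal rels" free_algebra by (rule ideal_relation_ideal)
  show "carrier (presented_algebra rels) = range (residue_class rels)"
  proof -
    have "carrier (presented_algebra rels) = a_rcosets\<^bsub>free_algebra\<^esub> relation_ideal rels"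
      by (simp add: presented_algebra_def ring.defs Let_def FactRing_def)
    also have "\<dots> = range (residue_class rels)"
      unfolding A_RCOSETS_def' residue_class_def by (auto simp: free_algebra_simps(1))
    finally show ?thesis .
  qed
  show "residue_class rels p \<otimes>\<^bsub>presented_algebra rels\<^esub> residue_class rels q = residue_class rels (p * q)" for p q
    using I.rcoset_mult_add[of p q]
    by (simp add: presented_algebra_def ring.defs Let_def FactRing_def residue_class_def free_algebra_simps)
  show "residue_class rels p \<oplus>\<^bsub>presented_algebra rels\<^esub> residue_class rels q = residue_class rels (p + q)" for p q
    using I.a_rcos_sum[of p q]
    by (simp add: presented_algebra_def ring.defs Let_def FactRing_def residue_class_def free_algebra_simps)
  show "\<one>\<^bsub>presented_algebra rels\<^esub> = residue_class rels 1"
    by (simp add: presented_algebra_def ring.defs Let_def FactRing_def residue_class_def free_algebra_simps)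
  show "\<zero>\<^bsub>presented_algebra rels\<^esub> = residue_class rels 0"
    using I.a_coset_add_zero I.a_rcos_zero
    by (simp add: presented_algebra_def ring.defs Let_def FactRing_def residue_class_def free_algebra_simps)
  show "c \<odot>\<^bsub>presented_algebra rels\<^esub> residue_class rels p = residue_class rels (const c * p)"
    using I.rcoset_mult_add[of "const c" p]
    by (simp add: presented_algebra_def ring.defs module.defs Let_def FactRing_def residue_class_def free_algebra_simps)
qed

lemma ring_presented_algebra: "ring (presented_algebra rels)"
proof (rule ringI)
  show "abelian_group (presented_algebra rels)"
  proof (rule abelian_groupI)
    fix x assume "x \<in> carrier (presented_algebra rels)"
    then obtain p where "x = residue_class rels p" by (auto simp: presented_algebra_simps)
    then show "\<exists>y\<in>carrier (presented_algebra rels). y \<oplus>\<^bsub>presented_algebra rels\<^esub> x = \<zero>\<^bsub>presented_algebra rels\<^esub>"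
      by (intro bexI[of _ "residue_class rels (- p)"]) (auto simp: presented_algebra_simps)
  qed (auto simp: presented_algebra_simps add.assoc add.commute add.left_commute)
  show "monoid (presented_algebra rels)"
    by (rule monoidI) (auto simp: presented_algebra_simps mult.assoc)
qed (auto simp: presented_algebra_simps distrib_left distrib_right)

lemma const_simps:
  "const (a + b) = const a + const b" "const (a * b) = const a * const b" "const 1 = 1"
  by (simp_all add: const_def single_add mult_single)

lemma const_central: "const c * p = p * const c"
proof (induction p rule: update_induct)
  case (update f a b)
  have "Poly_Mapping.update a b f = f + Poly_Mapping.single a b"
    using update.hyps(1)
    by (intro poly_mapping_eqI) (auto simp: Poly_Mapping.lookup_update lookup_add lookup_single in_keys_iff when_def)
  moreover have "const c * Poly_Mapping.single a b = Poly_Mapping.single a b * const c"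
    by (simp add: const_def mult_single mult.commute)
  ultimately show ?case
    using update.IH by (simp add: distrib_left distrib_right)
qed simp

lemma module_presented_algebra: "Module.module scalars (presented_algebra rels)"
proof (rule module.intro)
  show "cring scalars" unfolding scalars_def by (rule cring_from_type_algebra)
  show "abelian_group (presented_algebra rels)"
    using ring_presented_algebra by (rule ring.is_abelian_group)
  show "module_axioms scalars (presented_algebra rels)"
    by standard
      (auto simp: scalars_def ring_of_type_algebra_def presented_algebra_simps const_simps
        distrib_left distrib_right mult.assoc)
qed

lemma presented_algebra_smult_mult:
  fixes rels :: "('g word \<Rightarrow>\<^sub>0 'k::comm_ring_1) set"
  assumes "x \<in> carrier (presented_algebra rels)" "y \<in> carrier (presented_algebra rels)"
  shows "(c \<odot>\<^bsub>presented_algebra rels\<^esub> x) \<otimes>\<^bsub>presented_algebra rels\<^esub> y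
           = c \<odot>\<^bsub>presented_algebra rels\<^esub> (x \<otimes>\<^bsub>presented_algebra rels\<^esub> y)"
    and "x \<otimes>\<^bsub>presented_algebra rels\<^esub> (c \<odot>\<^bsub>presented_algebra rels\<^esub> y)
           = c \<odot>\<^bsub>presented_algebra rels\<^esub> (x \<otimes>\<^bsub>presented_algebra rels\<^esub> y)"
proof -
  obtain p q where "x = residue_class rels p" "y = residue_class rels q"
    using assms by (auto simp: presented_algebra_simps)
  moreover have "p * (const c * q) = const c * (p * q)"
    by (metis const_central mult.assoc)
  ultimately show
    "(c \<odot>\<^bsub>presented_algebra rels\<^esub> x) \<otimes>\<^bsub>presented_algebra rels\<^esub> y
       = c \<odot>\<^bsub>presented_algebra rels\<^esub> (x \<otimes>\<^bsub>presented_algebra rels\<^esub> y)"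
    "x \<otimes>\<^bsub>presented_algebra rels\<^esub> (c \<odot>\<^bsub>presented_algebra rels\<^esub> y)
       = c \<odot>\<^bsub>presented_algebra rels\<^esub> (x \<otimes>\<^bsub>presented_algebra rels\<^esub> y)"
    by (simp_all add: presented_algebra_simps mult.assoc)
qed

datatype 's gen = Gen_e 's | Gen_x

definition kwN_relations ::
    "('s::finite \<Rightarrow> 's) \<Rightarrow> nat \<Rightarrow> ('s gen word \<Rightarrow>\<^sub>0 'k::field) set"
  where "kwN_relations \<omega> N =
      {var (Gen_e s) * var (Gen_e t) - (if s = t then var (Gen_e t) else 0) | s t. True}
    \<union> {1 - (\<Sum>s\<in>UNIV. var (Gen_e s))}
    \<union> {var Gen_x ^ N}
    \<union> {var (Gen_e s) * var Gen_x - var Gen_x * var (Gen_e (\<omega> s)) | s. True}"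

definition kwN ::
    "('s::finite \<Rightarrow> 's) \<Rightarrow> nat \<Rightarrow> ('k::field, ('s gen word \<Rightarrow>\<^sub>0 'k) set) module"
  where "kwN \<omega> N = presented_algebra (kwN_relations \<omega> N)"

definition elt_e :: "('s::finite \<Rightarrow> 's) \<Rightarrow> nat \<Rightarrow> 's \<Rightarrow> ('s gen word \<Rightarrow>\<^sub>0 'k::field) set"
  where "elt_e \<omega> N s = residue_class (kwN_relations \<omega> N) (var (Gen_e s))"

definition elt_x :: "('s::finite \<Rightarrow> 's) \<Rightarrow> nat \<Rightarrow> ('s gen word \<Rightarrow>\<^sub>0 'k::field) set"
  where "elt_x \<omega> N = residue_class (kwN_relations \<omega> N) (var Gen_x)"

definition elt_ex :: "('s::finite \<Rightarrow> 's) \<Rightarrow> nat \<Rightarrow> 's \<Rightarrow> nat \<Rightarrow> ('s gen word \<Rightarrow>\<^sub>0 'k::field) set"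
  where "elt_ex \<omega> N s n = elt_e \<omega> N s \<otimes>\<^bsub>kwN \<omega> N\<^esub> (elt_x \<omega> N [^]\<^bsub>kwN \<omega> N\<^esub> n)"

abbreviation linear_subspace :: "('k::field, 'a) module \<Rightarrow> 'a set \<Rightarrow> bool"
  where "linear_subspace A W \<equiv> submodule W scalars A"

text \<open>
  The library's \<open>subalgebra\<close> only asks for closure under addition and scalars,
  so unital subalgebras are rendered as subrings that are also subspaces.
\<close>

definition subalgebra_generated :: "('k::field, 'a) module \<Rightarrow> 'a set \<Rightarrow> 'a set"
  where "subalgebra_generated A T = \<Inter>{B. subring B A \<and> linear_subspace A B \<and> T \<subseteq> B}"

definition is_direct_sum ::
    "('k::field, 'a) module \<Rightarrow> 'i set \<Rightarrow> ('i \<Rightarrow> 'a set) \<Rightarrow> 'a set \<Rightarrow> bool"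
  where "is_direct_sum A I V W \<longleftrightarrow>
      finite I
    \<and> (\<forall>i\<in>I. linear_subspace A (V i))
    \<and> W = {finsum A f I | f. f \<in> Pi I V}
    \<and> (\<forall>f\<in>Pi I V. finsum A f I = \<zero>\<^bsub>A\<^esub> \<longrightarrow> (\<forall>i\<in>I. f i = \<zero>\<^bsub>A\<^esub>))"

definition is_direct_sum2 ::
    "('k::field, 'a) module \<Rightarrow> 'a set \<Rightarrow> 'a set \<Rightarrow> 'a set \<Rightarrow> bool"
  where "is_direct_sum2 A U V W \<longleftrightarrow>
      linear_subspace A U \<and> linear_subspace A V
    \<and> W = U <+>\<^bsub>A\<^esub> V \<and> U \<inter> V = {\<zero>\<^bsub>A\<^esub>}"

definition bilinear_form :: "('k::field, 'a) module \<Rightarrow> ('a \<Rightarrow> 'a \<Rightarrow> 'k) \<Rightarrow> bool"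
  where "bilinear_form A B \<longleftrightarrow>
      (\<forall>u\<in>carrier A. \<forall>v\<in>carrier A. \<forall>w\<in>carrier A.
          B (u \<oplus>\<^bsub>A\<^esub> v) w = B u w + B v w \<and> B w (u \<oplus>\<^bsub>A\<^esub> v) = B w u + B w v)
    \<and> (\<forall>c. \<forall>u\<in>carrier A. \<forall>w\<in>carrier A.
          B (c \<odot>\<^bsub>A\<^esub> u) w = c * B u w \<and> B w (c \<odot>\<^bsub>A\<^esub> u) = c * B w u)"

definition perp_L :: "('k::field, 'a) module \<Rightarrow> ('a \<Rightarrow> 'a \<Rightarrow> 'k) \<Rightarrow> 'a set \<Rightarrow> 'a set"
  where "perp_L A B W = {v \<in> carrier A. \<forall>w\<in>W. B v w = 0}"

definition perp_R :: "('k::field, 'a) module \<Rightarrow> ('a \<Rightarrow> 'a \<Rightarrow> 'k) \<Rightarrow> 'a set \<Rightarrow> 'a set"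
  where "perp_R A B W = {v \<in> carrier A. \<forall>w\<in>W. B w v = 0}"

definition subalg_R :: "('s::finite \<Rightarrow> 's) \<Rightarrow> nat \<Rightarrow> ('s gen word \<Rightarrow>\<^sub>0 'k::field) set set"
  where "subalg_R \<omega> N = subalgebra_generated (kwN \<omega> N) {elt_x \<omega> N}"

definition N_mod ::
    "('s::finite \<Rightarrow> 's) \<Rightarrow> nat \<Rightarrow> 's \<Rightarrow> nat \<Rightarrow> ('s gen word \<Rightarrow>\<^sub>0 'k::field) set set"
  where "N_mod \<omega> N s t = {elt_ex \<omega> N s t \<otimes>\<^bsub>kwN \<omega> N\<^esub> r | r. r \<in> subalg_R \<omega> N}"

end

theory Submission
  imports Defs
begin

text \<open>
  The elements \<open>e\<^sub>s x\<^sup>n\<close> with \<open>n < N\<close> span the algebra, and each of them has a nonzero product with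
  exactly one of them on the right, through the permutation \<open>\<pi>(s, n) = (\<mu>(s), \<nu>(n))\<close> of the index set. Everything in the
  statement is therefore a span of some of these elements, and every claim reduces to a claim about
  sets of indices:

  \<^item> \<open>N\<^sub>s\<^sub>,\<^sub>t\<close> is spanned by the indices \<open>{s} \<times> [t, N)\<close> (lemma \<open>N_mod_eq_span\<close>);
  \<^item> the right complement of the span of an index set \<open>S\<close> is the span of the indices outside the
    image \<open>\<pi>(S)\<close>, and its left complement the span of the indices outside the preimage of \<open>S\<close>
    (lemmas \<open>perp_R_span\<close> and \<open>perp_L_span\<close>);
  \<^item> disjoint index sets have independent spans, whose sum is the span of the union
    (lemmas \<open>direct_sum_span\<close> and \<open>direct_sum2_span\<close>).

  For the strip \<open>{s} \<times> [m, N)\<close> the image is \<open>{\<mu>(s)} \<times> \<nu>([m, N))\<close>, and for \<open>{\<mu>\<^sup>2(s)} \<times> [m, N)\<close> the preimage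
  is \<open>{\<mu>(s)} \<times> \<nu>\<^sup>-\<^sup>1([m, N))\<close>. These agree when \<open>m = 0\<close>, as \<open>\<nu>\<close> is a permutation, and also when \<open>\<nu>\<close> is the
  reversal \<open>k \<mapsto> N - 1 - k\<close>, which is its own inverse and carries \<open>[m, N)\<close> to \<open>[0, N - m)\<close>.

  Linear independence of the \<open>e\<^sub>s x\<^sup>n\<close> is a consequence of the form rather than of a normal form for
  the presented algebra: pairing with the partner of an element reads off its coefficient. Only
  spanning has to be derived from the relations (lemma \<open>ex_spans\<close>).
\<close>

section \<open>Linear spans and linear functionals\<close>

lemma scalars_simps [simp]:
  "carrier scalars = UNIV" "a \<otimes>\<^bsub>scalars\<^esub> b = a * b" "a \<oplus>\<^bsub>scalars\<^esub> b = a + b"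
  "\<one>\<^bsub>scalars\<^esub> = 1" "\<zero>\<^bsub>scalars\<^esub> = 0"
  by (simp_all add: scalars_def ring_of_type_algebra_def)

abbreviation lin_span :: "('k::field, 'a) module \<Rightarrow> 'a set \<Rightarrow> 'a set"
  where "lin_span A G \<equiv> (\<lambda>W. linear_subspace A W) hull G"

definition linear_functional :: "('k::field, 'a) module \<Rightarrow> ('a \<Rightarrow> 'k) \<Rightarrow> bool"
  where "linear_functional A f \<longleftrightarrow>
      (\<forall>u\<in>carrier A. \<forall>v\<in>carrier A. f (u \<oplus>\<^bsub>A\<^esub> v) = f u + f v)
    \<and> (\<forall>c. \<forall>u\<in>carrier A. f (c \<odot>\<^bsub>A\<^esub> u) = c * f u)"

lemma bilinear_form_linear_functionals:
  assumes "bilinear_form A B" "w \<in> carrier A"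
  shows "linear_functional A (\<lambda>v. B v w)" "linear_functional A (B w)"
  using assms by (auto simp: bilinear_form_def linear_functional_def)

locale linear_space = Module.module scalars A
  for A :: "('k::field, 'a) module" (structure)
begin

lemma smult_zero_left [simp]: "v \<in> carrier A \<Longrightarrow> 0 \<odot> v = \<zero>"
  using smult_l_null by simp

lemma linear_subspaceI:
  assumes "W \<subseteq> carrier A" "\<zero> \<in> W"
    and "\<And>u v. u \<in> W \<Longrightarrow> v \<in> W \<Longrightarrow> u \<oplus> v \<in> W"
    and smult: "\<And>c u. u \<in> W \<Longrightarrow> c \<odot> u \<in> W"
  shows "linear_subspace A W"
proof (rule submoduleI)
  fix u assume "u \<in> W"
  then have "\<ominus> u = (\<ominus>\<^bsub>scalars\<^esub> 1) \<odot> u"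
    using assms(1) smult_l_minus[of 1 u] smult_one[of u] by auto
  then show "\<ominus> u \<in> W" using smult[OF \<open>u \<in> W\<close>] by simp
qed (use assms in auto)

lemma linear_subspaceD:
  assumes "linear_subspace A W"
  shows "W \<subseteq> carrier A" "\<zero> \<in> W"
    and "\<And>u v. u \<in> W \<Longrightarrow> v \<in> W \<Longrightarrow> u \<oplus> v \<in> W"
    and "\<And>c u. u \<in> W \<Longrightarrow> c \<odot> u \<in> W"
proof -
  note E = submoduleE[OF assms]
  show sub: "W \<subseteq> carrier A" by (rule E(1))
  show "c \<odot> u \<in> W" if "u \<in> W" for c u using E(4)[of c u] that by simp
  show "u \<oplus> v \<in> W" if "u \<in> W" "v \<in> W" for u v using E(5) that by blast
  obtain u where u: "u \<in> W" using E(2) by blast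
  then have "0 \<odot> u \<in> W" using E(4)[of 0 u] by simp
  then show "\<zero> \<in> W" using u sub by auto
qed

lemma finsum_in_linear_subspace:
  assumes W: "linear_subspace A W" and "f \<in> J \<rightarrow> W"
  shows "finsum A f J \<in> W"
proof (cases "finite J")
  case True
  then show ?thesis using assms(2)
  proof (induction J)
    case (insert j J)
    then have "f \<in> J \<rightarrow> carrier A" "f j \<in> carrier A"
      using linear_subspaceD(1)[OF W] by auto
    with insert show ?case by (simp add: linear_subspaceD(3)[OF W])
  qed (simp add: linear_subspaceD(2)[OF W])
qed (simp add: linear_subspaceD(2)[OF W])

lemma linear_subspace_carrier: "linear_subspace A (carrier A)"
  by (rule carrier_is_submodule)

lemma lin_span_subset_carrier: "G \<subseteq> carrier A \<Longrightarrow> lin_span A G \<subseteq> carrier A"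
  by (rule hull_minimal) (simp_all add: linear_subspace_carrier)

lemma linear_subspace_lin_span:
  assumes "G \<subseteq> carrier A"
  shows "linear_subspace A (lin_span A G)"
proof (rule linear_subspaceI)
  show "lin_span A G \<subseteq> carrier A" using assms by (rule lin_span_subset_carrier)
qed (auto simp: hull_def linear_subspaceD)

lemma zero_linear_functional: "linear_functional A (\<lambda>_. 0)"
  by (simp add: linear_functional_def)

lemma linear_functional_zero:
  assumes "linear_functional A f"
  shows "f \<zero> = 0"
proof -
  have "f (\<zero> \<oplus> \<zero>) = f \<zero> + f \<zero>"
    using assms M.zero_closed unfolding linear_functional_def by blast
  then have "f \<zero> + f \<zero> = f \<zero> + 0" by simp
  then show ?thesis by (rule add_left_imp_eq)
qed

lemma linear_functional_finsum:
  assumes f: "linear_functional A f" and "finite J" "g \<in> J \<rightarrow> carrier A"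
  shows "f (finsum A g J) = (\<Sum>j\<in>J. f (g j))"
  using assms(2,3)
proof (induction J)
  case (insert j J)
  have "g \<in> J \<rightarrow> carrier A" "g j \<in> carrier A" "finsum A g J \<in> carrier A"
    using insert.prems by (auto intro!: M.finsum_closed)
  moreover have "f (u \<oplus> v) = f u + f v" if "u \<in> carrier A" "v \<in> carrier A" for u v
    using f that by (auto simp: linear_functional_def)
  ultimately show ?case using insert by simp
qed (simp add: linear_functional_zero[OF f])

lemma linear_subspace_equalizer:
  assumes f: "linear_functional A f" and g: "linear_functional A g"
  shows "linear_subspace A {v \<in> carrier A. f v = g v}"
  by (rule linear_subspaceI)
    (use f g in \<open>auto simp: linear_functional_zero[OF f] linear_functional_zero[OF g],
      auto simp: linear_functional_def\<close>)

lemma linear_functionals_eq_on_lin_span: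
  assumes "linear_functional A f" "linear_functional A g" "G \<subseteq> carrier A"
    and "\<And>x. x \<in> G \<Longrightarrow> f x = g x" "v \<in> lin_span A G"
  shows "f v = g v"
proof -
  have "lin_span A G \<subseteq> {v \<in> carrier A. f v = g v}"
    by (rule hull_minimal) (use assms in \<open>auto intro: linear_subspace_equalizer\<close>)
  with assms(5) show ?thesis by blast
qed

lemma perp_lin_span:
  assumes B: "bilinear_form A B" and G: "G \<subseteq> carrier A"
  shows "perp_R A B (lin_span A G) = perp_R A B G" (is ?R)
    and "perp_L A B (lin_span A G) = perp_L A B G" (is ?L)
proof -
  note bl = bilinear_form_linear_functionals[OF B]
  have "B w v = 0" if "v \<in> carrier A" "\<And>x. x \<in> G \<Longrightarrow> B x v = 0" "w \<in> lin_span A G" for v w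
    using linear_functionals_eq_on_lin_span[OF bl(1) zero_linear_functional G] that by blast
  moreover have "B v w = 0" if "v \<in> carrier A" "\<And>x. x \<in> G \<Longrightarrow> B v x = 0" "w \<in> lin_span A G" for v w
    using linear_functionals_eq_on_lin_span[OF bl(2) zero_linear_functional G] that by blast
  ultimately show ?R ?L
    unfolding perp_R_def perp_L_def by (auto intro: hull_inc)
qed

end

section \<open>Forms that permute a spanning set\<close>

text \<open>
  A bilinear form whose matrix in the family \<open>b\<close> is a permutation matrix with nonzero weights. The
  family is only assumed to span; the form makes it a basis.
\<close>

locale monomial_form = linear_space A
  for A :: "('k::field, 'a) module" (structure) +
  fixes I :: "'i set" and b :: "'i \<Rightarrow> 'a" and \<pi> :: "'i \<Rightarrow> 'i" and d :: "'i \<Rightarrow> 'k"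
    and B :: "'a \<Rightarrow> 'a \<Rightarrow> 'k"
  assumes finite_I: "finite I"
    and b_closed: "b ` I \<subseteq> carrier A"
    and b_spans: "lin_span A (b ` I) = carrier A"
    and perm: "bij_betw \<pi> I I"
    and d_nonzero: "i \<in> I \<Longrightarrow> d i \<noteq> 0"
    and bilinear: "bilinear_form A B"
    and B_b: "\<lbrakk>i \<in> I; j \<in> I\<rbrakk> \<Longrightarrow> B (b i) (b j) = d i * of_bool (\<pi> i = j)"
begin

lemma b_in_carrier [simp]: "i \<in> I \<Longrightarrow> b i \<in> carrier A"
  using b_closed by auto

lemma perm_in [simp]: "i \<in> I \<Longrightarrow> \<pi> i \<in> I"
  using perm by (auto simp: bij_betw_def)

lemma perm_eq_iff: "\<lbrakk>i \<in> I; j \<in> I\<rbrakk> \<Longrightarrow> \<pi> i = \<pi> j \<longleftrightarrow> i = j"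
  using perm by (auto simp: bij_betw_def inj_on_def)

text \<open>
  The form itself supplies the dual basis: \<open>b (\<pi> i)\<close> is orthogonal on the right to every member of
  the family but \<open>b i\<close>.
\<close>

definition coord :: "'i \<Rightarrow> 'a \<Rightarrow> 'k"
  where "coord i v = B v (b (\<pi> i)) / d i"

lemma linear_functional_coord: "i \<in> I \<Longrightarrow> linear_functional A (coord i)"
  using bilinear_form_linear_functionals(1)[OF bilinear, of "b (\<pi> i)"]
  by (simp add: linear_functional_def coord_def add_divide_distrib)

lemma coord_b: "\<lbrakk>i \<in> I; j \<in> I\<rbrakk> \<Longrightarrow> coord i (b j) = of_bool (i = j)"
  using d_nonzero by (auto simp: coord_def B_b perm_eq_iff)

lemma coord_add:
  "\<lbrakk>i \<in> I; u \<in> carrier A; v \<in> carrier A\<rbrakk> \<Longrightarrow> coord i (u \<oplus> v) = coord i u + coord i v"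
  and coord_smult: "\<lbrakk>i \<in> I; u \<in> carrier A\<rbrakk> \<Longrightarrow> coord i (c \<odot> u) = c * coord i u"
  using linear_functional_coord by (auto simp: linear_functional_def)

lemma coord_zero: "i \<in> I \<Longrightarrow> coord i \<zero> = 0"
  by (rule linear_functional_zero[OF linear_functional_coord])

definition comb :: "('i \<Rightarrow> 'k) \<Rightarrow> 'a"
  where "comb c = (\<Oplus>i\<in>I. c i \<odot> b i)"

lemma comb_closed [simp]: "comb c \<in> carrier A"
  by (auto simp: comb_def intro!: M.finsum_closed)

lemma coord_comb: "i \<in> I \<Longrightarrow> coord i (comb c) = c i"
  unfolding comb_def
  by (subst linear_functional_finsum[OF linear_functional_coord])
    (auto simp: finite_I coord_smult coord_b of_bool_def if_distrib[of "\<lambda>x. _ * x"] cong: if_cong)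

text \<open>
  Linear combinations form a subspace containing the family, so the spanning assumption makes
  every vector a combination; its coefficients can only be its coordinates.
\<close>

lemma comb_coord:
  assumes "v \<in> carrier A"
  shows "comb (\<lambda>i. coord i v) = v"
proof -
  have "linear_subspace A (range comb)"
  proof (rule linear_subspaceI)
    have "\<zero> = comb (\<lambda>_. 0)"
      by (auto simp: comb_def intro!: M.finsum_zero[symmetric] cong: M.finsum_cong)
    then show "\<zero> \<in> range comb" by blast
    fix u v assume "u \<in> range comb" "v \<in> range comb"
    moreover have "comb c \<oplus> comb c' = comb (\<lambda>i. c i + c' i)" for c c'
    proof -
      have "comb (\<lambda>i. c i + c' i) = (\<Oplus>i\<in>I. c i \<odot> b i \<oplus> c' i \<odot> b i)"
        unfolding comb_def by (rule M.finsum_cong') (auto simp: smult_l_distr[simplified])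
      also have "\<dots> = comb c \<oplus> comb c'"
        unfolding comb_def by (rule M.finsum_addf) auto
      finally show ?thesis by (rule sym)
    qed
    ultimately show "u \<oplus> v \<in> range comb" by auto
  next
    fix a u assume "u \<in> range comb"
    moreover have "a \<odot> comb c = comb (\<lambda>i. a * c i)" for c
      unfolding comb_def
      by (subst finsum_smult_ldistr)
        (auto intro!: M.finsum_cong' simp: finite_I smult_assoc1[simplified])
    ultimately show "a \<odot> u \<in> range comb" by auto
  qed auto
  moreover have "b i \<in> range comb" if "i \<in> I" for i
  proof -
    have "comb (\<lambda>j. of_bool (i = j)) = (\<Oplus>j\<in>I. if i = j then b j else \<zero>)"
      unfolding comb_def by (rule M.finsum_cong') (auto simp: smult_one[simplified])
    also have "\<dots> = b i"
      using that finite_I by (intro M.finsum_singleton) auto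
    finally show ?thesis by (metis rangeI)
  qed
  ultimately have "lin_span A (b ` I) \<subseteq> range comb"
    by (intro hull_minimal) auto
  then obtain c where c: "v = comb c"
    using assms b_spans by auto
  show ?thesis
    unfolding c comb_def by (rule M.finsum_cong') (auto simp: coord_comb[unfolded comb_def])
qed

lemma coord_eqI:
  assumes "u \<in> carrier A" "v \<in> carrier A" "\<And>i. i \<in> I \<Longrightarrow> coord i u = coord i v"
  shows "u = v"
proof -
  have "comb (\<lambda>i. coord i u) = comb (\<lambda>i. coord i v)"
    unfolding comb_def by (rule M.finsum_cong') (auto simp: assms)
  then show ?thesis by (simp add: comb_coord assms)
qed

lemma span_subset_carrier: "S \<subseteq> I \<Longrightarrow> b ` S \<subseteq> carrier A"
  by auto

text \<open>
  This criterion turns each statement about spans of subfamilies into one about index sets.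
\<close>

lemma mem_span_iff:
  assumes "S \<subseteq> I"
  shows "v \<in> lin_span A (b ` S) \<longleftrightarrow> v \<in> carrier A \<and> (\<forall>i\<in>I - S. coord i v = 0)"
proof (intro iffI conjI ballI)
  assume v: "v \<in> lin_span A (b ` S)"
  then show "v \<in> carrier A"
    using lin_span_subset_carrier[OF span_subset_carrier[OF assms]] by blast
  fix i assume i: "i \<in> I - S"
  show "coord i v = 0"
    by (rule linear_functionals_eq_on_lin_span[OF linear_functional_coord zero_linear_functional _ _ v])
      (use i assms in \<open>auto simp: coord_b subset_iff\<close>)
next
  assume v: "v \<in> carrier A \<and> (\<forall>i\<in>I - S. coord i v = 0)"
  note sub = linear_subspace_lin_span[OF span_subset_carrier[OF assms]]
  have "coord i v \<odot> b i \<in> lin_span A (b ` S)" if "i \<in> I" for i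
  proof (cases "i \<in> S")
    case True
    then have "b i \<in> lin_span A (b ` S)" by (auto intro: hull_inc)
    then show ?thesis using linear_subspaceD(4)[OF sub] by blast
  next
    case False
    then show ?thesis using v that linear_subspaceD(2)[OF sub] by simp
  qed
  then have "comb (\<lambda>i. coord i v) \<in> lin_span A (b ` S)"
    unfolding comb_def by (intro finsum_in_linear_subspace[OF sub]) auto
  then show "v \<in> lin_span A (b ` S)" using v comb_coord by simp
qed

lemma B_b_left:
  assumes "i \<in> I" "v \<in> carrier A"
  shows "B (b i) v = d i * coord (\<pi> i) v"
proof (rule linear_functionals_eq_on_lin_span)
  show "v \<in> lin_span A (b ` I)" using assms b_spans by simp
  show "B (b i) w = d i * coord (\<pi> i) w" if "w \<in> b ` I" for w
    using that assms by (auto simp: B_b coord_b)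
  show "linear_functional A (B (b i))"
    using bilinear_form_linear_functionals(2)[OF bilinear] assms by simp
  show "linear_functional A (\<lambda>v. d i * coord (\<pi> i) v)"
    using assms by (simp add: linear_functional_def coord_add coord_smult distrib_left)
qed (rule b_closed)

lemma B_b_right: "\<lbrakk>i \<in> I; v \<in> carrier A\<rbrakk> \<Longrightarrow> B v (b (\<pi> i)) = d i * coord i v"
  using d_nonzero by (simp add: coord_def)

text \<open>
  Orthogonality to \<open>b i\<close> from the right kills coordinate \<open>\<pi> i\<close>, since the weights are nonzero. From
  the left it kills the coordinate at the preimage of \<open>i\<close>, hence the asymmetry with \<open>perp_L_span\<close>.
\<close>

lemma perp_R_span:
  assumes "S \<subseteq> I"
  shows "perp_R A B (lin_span A (b ` S)) = lin_span A (b ` (I - \<pi> ` S))"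
proof -
  have "perp_R A B (lin_span A (b ` S)) = perp_R A B (b ` S)"
    using perp_lin_span(1)[OF bilinear span_subset_carrier[OF assms]] .
  also have "\<dots> = {v \<in> carrier A. \<forall>i\<in>S. coord (\<pi> i) v = 0}"
    unfolding perp_R_def using assms d_nonzero by (auto simp: B_b_left subset_iff)
  also have "\<dots> = lin_span A (b ` (I - \<pi> ` S))"
    using assms by (auto simp: mem_span_iff subset_iff)
  finally show ?thesis .
qed

lemma perp_L_span:
  assumes "S \<subseteq> I"
  shows "perp_L A B (lin_span A (b ` S)) = lin_span A (b ` {i \<in> I. \<pi> i \<notin> S})"
proof -
  have "perp_L A B (lin_span A (b ` S)) = perp_L A B (b ` S)"
    using perp_lin_span(2)[OF bilinear span_subset_carrier[OF assms]] .
  also have "\<dots> = {v \<in> carrier A. \<forall>i\<in>I. \<pi> i \<in> S \<longrightarrow> coord i v = 0}"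
  proof -
    have "(\<forall>j\<in>S. B v (b j) = 0) \<longleftrightarrow> (\<forall>i\<in>I. \<pi> i \<in> S \<longrightarrow> B v (b (\<pi> i)) = 0)" for v
    proof -
      have "S = \<pi> ` {i \<in> I. \<pi> i \<in> S}" using assms perm by (auto simp: bij_betw_def)
      then have "(\<forall>j\<in>S. B v (b j) = 0) \<longleftrightarrow> (\<forall>j\<in>\<pi> ` {i \<in> I. \<pi> i \<in> S}. B v (b j) = 0)"
        by (rule arg_cong)
      then show ?thesis by auto
    qed
    then show ?thesis
      unfolding perp_L_def using d_nonzero by (auto simp: B_b_right)
  qed
  also have "\<dots> = lin_span A (b ` {i \<in> I. \<pi> i \<notin> S})"
    by (auto simp: mem_span_iff)
  finally show ?thesis .
qed

text \<open>
  Cutting a vector down to the coordinates in \<open>S\<close> gives its component in the span of \<open>b ` S\<close>; these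
  truncations are the summands in the decompositions below.
\<close>

definition proj :: "'i set \<Rightarrow> 'a \<Rightarrow> 'a"
  where "proj S v = comb (\<lambda>i. of_bool (i \<in> S) * coord i v)"

lemma proj_closed [simp]: "proj S v \<in> carrier A"
  by (simp add: proj_def)

lemma coord_proj: "i \<in> I \<Longrightarrow> coord i (proj S v) = of_bool (i \<in> S) * coord i v"
  by (simp add: proj_def coord_comb)

lemma proj_in_span: "S \<subseteq> I \<Longrightarrow> proj S v \<in> lin_span A (b ` S)"
  by (auto simp: mem_span_iff coord_proj)

text \<open>
  By disjointness an index \<open>i\<close> lies in at most one \<open>S j\<close>, so coordinate \<open>i\<close> of a sum sees only the
  summand \<open>f j\<close>. This gives both that the truncations of a vector add up to it and that the summands
  of a vanishing sum vanish.
\<close>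

lemma direct_sum_span:
  assumes J: "finite J" and S: "\<And>j. j \<in> J \<Longrightarrow> S j \<subseteq> I"
    and disj: "disjoint_family_on S J"
  shows "is_direct_sum A J (\<lambda>j. lin_span A (b ` S j)) (lin_span A (b ` (\<Union>j\<in>J. S j)))"
proof -
  let ?V = "\<lambda>j. lin_span A (b ` S j)" and ?U = "\<Union>j\<in>J. S j"
  have U: "?U \<subseteq> I" using S by blast
  have V: "linear_subspace A (?V j)" if "j \<in> J" for j
    using linear_subspace_lin_span span_subset_carrier S that by blast
  have closed: "f \<in> J \<rightarrow> carrier A" if "f \<in> Pi J ?V" for f
    using that linear_subspaceD(1)[OF V] by (auto simp: Pi_iff)
  have coord_finsum: "coord i (finsum A f J) = (\<Sum>j\<in>J. coord i (f j))"
    if "i \<in> I" "f \<in> J \<rightarrow> carrier A" for i f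
    by (rule linear_functional_finsum[OF linear_functional_coord J]) (use that in auto)
  have coord_finsum_at: "coord i (finsum A f J) = coord i (f j)"
    if f: "f \<in> Pi J ?V" and ij: "j \<in> J" "i \<in> S j" for f i j
  proof -
    have i: "i \<in> I" using S ij by blast
    have "coord i (f k) = 0" if "k \<in> J" "k \<noteq> j" for k
    proof -
      have "i \<notin> S k" using disj ij that unfolding disjoint_family_on_def by blast
      moreover have "f k \<in> ?V k" using f that by blast
      ultimately show ?thesis using i S that by (auto simp: mem_span_iff)
    qed
    then have "(\<Sum>k\<in>J. coord i (f k)) = (\<Sum>k\<in>J. if k = j then coord i (f j) else 0)"
      by (intro sum.cong) auto
    with J ij(1) show ?thesis
      by (simp add: coord_finsum[OF i closed[OF f]])
  qed
  have "finsum A f J \<in> lin_span A (b ` ?U)" if "f \<in> Pi J ?V" for f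
  proof (rule finsum_in_linear_subspace)
    show "linear_subspace A (lin_span A (b ` ?U))"
      by (rule linear_subspace_lin_span[OF span_subset_carrier[OF U]])
    have "?V j \<subseteq> lin_span A (b ` ?U)" if "j \<in> J" for j
      using that by (intro hull_mono) blast
    then show "f \<in> J \<rightarrow> lin_span A (b ` ?U)" using \<open>f \<in> Pi J ?V\<close> by blast
  qed
  moreover have "\<exists>f\<in>Pi J ?V. w = finsum A f J" if w: "w \<in> lin_span A (b ` ?U)" for w
  proof (rule bexI)
    show f: "(\<lambda>j. proj (S j) w) \<in> Pi J ?V" using proj_in_span S by blast
    have wc: "w \<in> carrier A" and w0: "\<And>i. i \<in> I - ?U \<Longrightarrow> coord i w = 0"
      using w mem_span_iff[OF U] by auto
    show "w = finsum A (\<lambda>j. proj (S j) w) J"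
    proof (rule coord_eqI)
      fix i assume i: "i \<in> I"
      show "coord i w = coord i (finsum A (\<lambda>j. proj (S j) w) J)"
      proof (cases "i \<in> ?U")
        case True
        then obtain j where "j \<in> J" "i \<in> S j" by blast
        then show ?thesis using coord_finsum_at[OF f] i by (simp add: coord_proj)
      next
        case False
        then show ?thesis using i w0 coord_finsum[OF i closed[OF f]]
          by (auto simp: coord_proj)
      qed
    qed (use wc in \<open>auto intro: M.finsum_closed\<close>)
  qed
  moreover have "f j = \<zero>" if f: "f \<in> Pi J ?V" and "finsum A f J = \<zero>" and j: "j \<in> J" for f j
  proof (rule coord_eqI)
    fix i assume i: "i \<in> I"
    show "coord i (f j) = coord i \<zero>"
    proof (cases "i \<in> S j")
      case True
      then show ?thesis using coord_finsum_at[OF f j] that by simp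
    next
      case False
      have "f j \<in> ?V j" using f j by blast
      then show ?thesis using False i j S by (auto simp: mem_span_iff coord_zero)
    qed
  qed (use closed[OF f] j in auto)
  ultimately show ?thesis
    unfolding is_direct_sum_def using J V by blast
qed

lemma direct_sum2_span:
  assumes ST: "S \<subseteq> I" "T \<subseteq> I" and disj: "S \<inter> T = {}"
  shows "is_direct_sum2 A (lin_span A (b ` S)) (lin_span A (b ` T)) (lin_span A (b ` (S \<union> T)))"
    (is "is_direct_sum2 A ?S ?T ?U")
proof -
  have sub: "linear_subspace A (lin_span A (b ` U))" if "U \<subseteq> I" for U
    by (rule linear_subspace_lin_span[OF span_subset_carrier[OF that]])
  have ST': "S \<union> T \<subseteq> I" using ST by blast
  have "?U = ?S <+>\<^bsub>A\<^esub> ?T"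
  proof
    show "?U \<subseteq> ?S <+>\<^bsub>A\<^esub> ?T"
    proof
      fix w assume "w \<in> ?U"
      then have "w \<in> carrier A" and w0: "\<And>i. i \<in> I \<Longrightarrow> i \<notin> S \<Longrightarrow> i \<notin> T \<Longrightarrow> coord i w = 0"
        by (simp_all add: mem_span_iff[OF ST'])
      from this(1) have "w = proj S w \<oplus> proj T w"
      proof (rule coord_eqI)
        fix i assume "i \<in> I"
        then show "coord i w = coord i (proj S w \<oplus> proj T w)"
          using disj w0[of i] by (auto simp: coord_add coord_proj)
      qed simp
      then show "w \<in> ?S <+>\<^bsub>A\<^esub> ?T"
        unfolding AbelCoset.set_add_def' using proj_in_span[OF ST(1)] proj_in_span[OF ST(2)] by blast
    qed
    have "?S \<subseteq> ?U" "?T \<subseteq> ?U" by (intro hull_mono image_mono; blast)+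
    then show "?S <+>\<^bsub>A\<^esub> ?T \<subseteq> ?U"
      unfolding AbelCoset.set_add_def' using linear_subspaceD(3)[OF sub[OF ST']] by blast
  qed
  moreover have "?S \<inter> ?T = {\<zero>}"
  proof
    show "{\<zero>} \<subseteq> ?S \<inter> ?T" using linear_subspaceD(2)[OF sub] ST by simp
    show "?S \<inter> ?T \<subseteq> {\<zero>}"
    proof
      fix u assume "u \<in> ?S \<inter> ?T"
      then have u: "u \<in> carrier A" "\<And>i. i \<in> I \<Longrightarrow> i \<notin> S \<or> i \<notin> T \<Longrightarrow> coord i u = 0"
        by (auto simp: mem_span_iff ST)
      have "u = \<zero>"
        by (rule coord_eqI) (use u disj in \<open>auto simp: coord_zero\<close>)
      then show "u \<in> {\<zero>}" by simp
    qed
  qed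
  ultimately show ?thesis
    unfolding is_direct_sum2_def by (simp add: sub ST)
qed

end

section \<open>Algebras given by generators and relations\<close>

lemma residue_class_power: "residue_class rels p [^]\<^bsub>presented_algebra rels\<^esub> (n::nat) = residue_class rels (p ^ n)"
proof (induction n)
  case (Suc n)
  then show ?case
    by (simp only: nat_pow_def) (simp add: presented_algebra_simps power_Suc2 del: power_Suc)
qed (simp add: nat_pow_def presented_algebra_simps)

lemma residue_class_sum:
  assumes "finite J"
  shows "finsum (presented_algebra rels) (\<lambda>j. residue_class rels (f j)) J
    = residue_class rels (sum f J)"
  using assms
proof (induction J)
  interpret P: ring "presented_algebra rels" by (rule ring_presented_algebra)
  {
    case empty
    show ?case by (simp add: presented_algebra_simps)
  next
    case (insert j J)
    then show ?case by (simp add: presented_algebra_simps Pi_def)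
  }
qed

lemma residue_class_relation:
  assumes "p - q \<in> rels"
  shows "residue_class rels p = residue_class rels q"
proof -
  interpret I: ideal "relation_ideal rels" free_algebra by (rule ideal_relation_ideal)
  interpret P: ring "presented_algebra rels" by (rule ring_presented_algebra)
  have "rels \<subseteq> relation_ideal rels"
    unfolding relation_ideal_def
    by (rule ring.genideal_self[OF ring_free_algebra]) (simp add: free_algebra_simps)
  moreover have "0 \<in> relation_ideal rels"
    using additive_subgroup.zero_closed[OF I.additive_subgroup_axioms] by (simp add: free_algebra_simps)
  ultimately have "residue_class rels (p - q) = residue_class rels 0"
    using assms unfolding residue_class_def by (metis I.a_rcos_const subsetD)
  then have "residue_class rels ((p - q) + q) = residue_class rels (0 + q)"
    by (metis presented_algebra_simps(3))
  then show ?thesis by simp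
qed

text \<open>
  An induction principle: the words are products of generators, and the free algebra is spanned by
  the words.
\<close>

lemma presented_algebra_least:
  fixes rels :: "('g word \<Rightarrow>\<^sub>0 'k::field) set"
  assumes sr: "subring L (presented_algebra rels)"
    and sub: "linear_subspace (presented_algebra rels) L"
    and var: "\<And>g. residue_class rels (var g) \<in> L"
  shows "carrier (presented_algebra rels) \<subseteq> L"
proof -
  interpret P: linear_space "presented_algebra rels"
    unfolding linear_space_def by (rule module_presented_algebra)
  note E = subringE[OF sr] and D = P.linear_subspaceD[OF sub]
  have word: "residue_class rels (Poly_Mapping.single (Word w) 1) \<in> L" for w
  proof (induction w)
    case Nil
    then show ?case
      using E(3) by (simp add: presented_algebra_simps zero_word_def flip: single_one)
  next
    case (Cons g w)
    have "Poly_Mapping.single (Word (g # w)) 1 = var g * (Poly_Mapping.single (Word w) 1 :: 'g word \<Rightarrow>\<^sub>0 'k)"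
      by (simp add: var_def mult_single plus_word_def)
    then show ?case
      using E(6)[OF var Cons] by (simp add: presented_algebra_simps)
  qed
  have "residue_class rels p \<in> L" for p
  proof (induction p rule: update_induct)
    case const
    show ?case using E(2) by (simp add: presented_algebra_simps)
  next
    case (update f a b)
    \<comment> \<open>Overwriting at a word outside the support adds a multiple of that word.\<close>
    have "Poly_Mapping.update a b f = f + const b * Poly_Mapping.single (Word (letters a)) 1"
      using update.hyps(1)
      by (intro poly_mapping_eqI)
        (auto simp: Poly_Mapping.lookup_update lookup_add lookup_single in_keys_iff when_def const_def mult_single)
    then show ?case
      using D(3)[OF update.IH D(4)[OF word[of "letters a"], of b]]
      by (simp only: presented_algebra_simps)
  qed
  then show ?thesis by (auto simp: presented_algebra_simps)
qed

section \<open>The monomials in the algebra and its submodules\<close>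

locale kwN_algebra =
  fixes \<omega> :: "'s::finite \<Rightarrow> 's" and N :: nat
    and K :: "('k::field, ('s gen word \<Rightarrow>\<^sub>0 'k) set) module" (structure)
  assumes K_def: "K = kwN \<omega> N"
begin

sublocale linear_space K
  unfolding linear_space_def K_def kwN_def by (rule module_presented_algebra)

sublocale ring K
  unfolding K_def kwN_def by (rule ring_presented_algebra)

abbreviation (input) e :: "'s \<Rightarrow> ('s gen word \<Rightarrow>\<^sub>0 'k) set" where "e \<equiv> elt_e \<omega> N"
abbreviation (input) x :: "('s gen word \<Rightarrow>\<^sub>0 'k) set" where "x \<equiv> elt_x \<omega> N"
abbreviation (input) ex :: "'s \<Rightarrow> nat \<Rightarrow> ('s gen word \<Rightarrow>\<^sub>0 'k) set" where "ex \<equiv> elt_ex \<omega> N"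

lemma smult_mult:
  assumes "u \<in> carrier K" "v \<in> carrier K"
  shows "(c \<odot> u) \<otimes> v = c \<odot> (u \<otimes> v)" "u \<otimes> (c \<odot> v) = c \<odot> (u \<otimes> v)"
  using presented_algebra_smult_mult[OF assms[unfolded K_def kwN_def]]
  by (simp_all only: K_def kwN_def)

lemma e_closed [simp]: "e s \<in> carrier K"
  and x_closed [simp]: "x \<in> carrier K"
  by (auto simp: K_def kwN_def elt_e_def elt_x_def presented_algebra_simps)

lemma ex_eq: "ex s n = e s \<otimes> x [^] n"
  by (simp add: elt_ex_def K_def)

lemma ex_closed [simp]: "ex s n \<in> carrier K"
  by (simp add: ex_eq)

lemma e_mult_e: "e s \<otimes> e t = (if s = t then e t else \<zero>)"
proof -
  let ?r = "residue_class (kwN_relations \<omega> N) :: _ \<Rightarrow> ('s gen word \<Rightarrow>\<^sub>0 'k) set"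
  have "var (Gen_e s) * var (Gen_e t) - (if s = t then var (Gen_e t) else 0)
      \<in> (kwN_relations \<omega> N :: ('s gen word \<Rightarrow>\<^sub>0 'k) set)"
    unfolding kwN_relations_def by blast
  then have "?r (var (Gen_e s) * var (Gen_e t)) = ?r (if s = t then var (Gen_e t) else 0)"
    by (rule residue_class_relation)
  also have "\<dots> = (if s = t then ?r (var (Gen_e t)) else ?r 0)"
    by (rule if_distrib)
  finally show ?thesis
    by (simp only: K_def kwN_def elt_e_def presented_algebra_simps)
qed

lemma sum_e: "(\<Oplus>s\<in>UNIV. e s) = \<one>"
proof -
  let ?r = "residue_class (kwN_relations \<omega> N) :: _ \<Rightarrow> ('s gen word \<Rightarrow>\<^sub>0 'k) set"
  have "1 - (\<Sum>s\<in>UNIV. var (Gen_e s)) \<in> (kwN_relations \<omega> N :: ('s gen word \<Rightarrow>\<^sub>0 'k) set)"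
    unfolding kwN_relations_def by blast
  then have "?r 1 = ?r (\<Sum>s\<in>UNIV. var (Gen_e s))"
    by (rule residue_class_relation)
  then show ?thesis
    by (simp only: K_def kwN_def elt_e_def presented_algebra_simps residue_class_sum finite)
qed

lemma e_mult_x: "e s \<otimes> x = x \<otimes> e (\<omega> s)"
proof -
  have "var (Gen_e s) * var Gen_x - var Gen_x * var (Gen_e (\<omega> s)) \<in> kwN_relations \<omega> N"
    unfolding kwN_relations_def by blast
  from residue_class_relation[OF this] show ?thesis
    by (simp add: K_def kwN_def elt_e_def elt_x_def presented_algebra_simps)
qed

lemma x_pow_N: "x [^] N = \<zero>"
proof -
  have "var Gen_x ^ N - 0 \<in> kwN_relations \<omega> N"
    unfolding kwN_relations_def by simp
  from residue_class_relation[OF this] show ?thesis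
    by (simp add: K_def kwN_def elt_x_def presented_algebra_simps residue_class_power)
qed

lemma ex_mult_x_pow: "ex s n \<otimes> x [^] k = ex s (n + k)"
  by (simp add: ex_eq m_assoc nat_pow_mult)

lemma ex_eq_zero: "N \<le> n \<Longrightarrow> ex s n = \<zero>"
proof -
  assume "N \<le> n"
  then have "x [^] n = x [^] N \<otimes> x [^] (n - N)" by (simp add: nat_pow_mult)
  then show ?thesis by (simp add: ex_eq x_pow_N)
qed

lemma e_mult_ex: "e t \<otimes> ex s n = (if t = s then ex s n else \<zero>)"
  by (simp add: ex_eq e_mult_e flip: m_assoc)

lemma x_mult_ex: "x \<otimes> ex (\<omega> s) n = ex s (Suc n)"
proof -
  have "x \<otimes> ex (\<omega> s) n = (e s \<otimes> x) \<otimes> x [^] n"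
    by (simp add: ex_eq e_mult_x m_assoc)
  also have "\<dots> = ex s (Suc n)"
    using nat_pow_mult[of x 1 n] by (simp add: ex_eq m_assoc)
  finally show ?thesis .
qed

lemma linear_subspace_preimage:
  assumes W: "linear_subspace K W" and a: "a \<in> carrier K"
  shows "linear_subspace K {v \<in> carrier K. a \<otimes> v \<in> W}" (is ?L)
    and "linear_subspace K {v \<in> carrier K. v \<otimes> a \<in> W}" (is ?R)
proof -
  note D = linear_subspaceD(2-4)[OF W]
  show ?L
    by (rule linear_subspaceI) (simp_all add: a D r_distr smult_mult subset_iff)
  show ?R
    by (rule linear_subspaceI) (simp_all add: a D l_distr smult_mult subset_iff)
qed

lemma linear_subspace_image:
  assumes W: "linear_subspace K W" and a: "a \<in> carrier K"
  shows "linear_subspace K {a \<otimes> v |v. v \<in> W}"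
proof (rule linear_subspaceI)
  note D = linear_subspaceD[OF W]
  have Wc: "v \<in> carrier K" if "v \<in> W" for v using D(1) that by blast
  show "{a \<otimes> v |v. v \<in> W} \<subseteq> carrier K" using a Wc by auto
  have "\<zero> = a \<otimes> \<zero>" using a by simp
  then show "\<zero> \<in> {a \<otimes> v |v. v \<in> W}" using D(2) by blast
  have sum: "a \<otimes> u \<oplus> a \<otimes> v = a \<otimes> (u \<oplus> v)" if "u \<in> W" "v \<in> W" for u v
    using a that by (simp add: r_distr Wc)
  show "u \<oplus> v \<in> {a \<otimes> v |v. v \<in> W}"
    if uv: "u \<in> {a \<otimes> v |v. v \<in> W}" "v \<in> {a \<otimes> v |v. v \<in> W}" for u v
  proof -
    obtain u' v' where "u = a \<otimes> u'" "v = a \<otimes> v'" "u' \<in> W" "v' \<in> W" using uv by blast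
    then show ?thesis using sum D(3) by blast
  qed
  have smult: "c \<odot> (a \<otimes> u) = a \<otimes> (c \<odot> u)" if "u \<in> W" for c u
    using a that by (simp add: smult_mult Wc)
  show "c \<odot> u \<in> {a \<otimes> v |v. v \<in> W}" if u: "u \<in> {a \<otimes> v |v. v \<in> W}" for c u
  proof -
    obtain u' where "u = a \<otimes> u'" "u' \<in> W" using u by blast
    then show ?thesis using smult D(4) by blast
  qed
qed

text \<open>
  Used with minimality of a generated subalgebra: to see that a subspace is stable under
  multiplication by all elements of that subalgebra, it suffices to check its generators.
\<close>

lemma stabilizer_subalgebra:
  assumes W: "linear_subspace K W"
  shows "subring {a \<in> carrier K. \<forall>v\<in>W. a \<otimes> v \<in> W} K" (is "subring ?L K")
    and "linear_subspace K {a \<in> carrier K. \<forall>v\<in>W. a \<otimes> v \<in> W}"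
    and "subring {a \<in> carrier K. \<forall>v\<in>W. v \<otimes> a \<in> W} K" (is "subring ?R K")
    and "linear_subspace K {a \<in> carrier K. \<forall>v\<in>W. v \<otimes> a \<in> W}"
proof -
  note D = linear_subspaceD(2-4)[OF W]
  have Wc: "v \<in> carrier K" if "v \<in> W" for v using linear_subspaceD(1)[OF W] that by blast
  show L: "linear_subspace K ?L"
    by (rule linear_subspaceI) (simp_all add: Wc D l_distr smult_mult subset_iff)
  show R: "linear_subspace K ?R"
    by (rule linear_subspaceI) (simp_all add: Wc D r_distr smult_mult subset_iff)
  show "subring ?L K"
  proof (rule subringI)
    show "\<ominus> a \<in> ?L" if "a \<in> ?L" for a using submoduleE(3)[OF L that] .
    show "a \<oplus> b \<in> ?L" if "a \<in> ?L" "b \<in> ?L" for a b using linear_subspaceD(3)[OF L that] .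
  qed (simp_all add: Wc m_assoc subset_iff)
  show "subring ?R K"
  proof (rule subringI)
    show "\<ominus> a \<in> ?R" if "a \<in> ?R" for a using submoduleE(3)[OF R that] .
    show "a \<oplus> b \<in> ?R" if "a \<in> ?R" "b \<in> ?R" for a b using linear_subspaceD(3)[OF R that] .
  qed (simp_all add: Wc subset_iff flip: m_assoc)
qed

text \<open>
  Left multiplication by a generator sends a monomial to a monomial or to zero: \<open>e\<^sub>t\<close> by
  orthogonality, and \<open>x\<close> because \<open>x e\<^sub>u = e\<^sub>s x\<close> for \<open>u = \<omega>(s)\<close>, where surjectivity of \<open>\<omega>\<close> enters.
  Hence the span is a left ideal. It contains the sum of the \<open>e\<^sub>s\<close>, which is \<open>1\<close>.
\<close>

lemma ex_spans:
  assumes "surj \<omega>"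
  shows "lin_span K (case_prod ex ` (UNIV \<times> {..<N})) = carrier K" (is "?V = _")
proof
  have sub: "linear_subspace K ?V"
    by (rule linear_subspace_lin_span) auto
  then show "?V \<subseteq> carrier K" by (rule linear_subspaceD)
  have ex_in: "ex s n \<in> ?V" for s n
  proof (cases "n < N")
    case True
    then have "case_prod ex (s, n) \<in> ?V" by (intro hull_inc imageI) auto
    then show ?thesis by simp
  next
    case False
    then show ?thesis using linear_subspaceD(2)[OF sub] by (simp add: ex_eq_zero)
  qed
  let ?L = "{a \<in> carrier K. \<forall>v\<in>?V. a \<otimes> v \<in> ?V}"
  have gen: "a \<in> ?L" if a: "a \<in> carrier K" "\<And>s n. a \<otimes> ex s n \<in> ?V" for a
  proof -
    have "?V \<subseteq> {v \<in> carrier K. a \<otimes> v \<in> ?V}"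
      by (rule hull_minimal) (use a in \<open>auto intro: linear_subspace_preimage[OF sub]\<close>)
    then show ?thesis using a by blast
  qed
  have "e t \<in> ?L" for t
    by (rule gen) (auto simp: e_mult_ex ex_in linear_subspaceD(2)[OF sub])
  moreover have "x \<in> ?L"
  proof (rule gen)
    fix s n
    obtain s' where "s = \<omega> s'" using assms by blast
    then show "x \<otimes> ex s n \<in> ?V" by (simp add: x_mult_ex ex_in)
  qed simp
  ultimately have "residue_class (kwN_relations \<omega> N) (var g) \<in> ?L" for g
    by (cases g) (auto simp: elt_e_def elt_x_def)
  then have "carrier K \<subseteq> ?L"
    using presented_algebra_least[of ?L "kwN_relations \<omega> N"] stabilizer_subalgebra(1,2)[OF sub]
    unfolding K_def kwN_def by blast
  moreover have "\<one> \<in> ?V"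
  proof -
    have "(\<Oplus>s\<in>UNIV. ex s 0) \<in> ?V"
      by (rule finsum_in_linear_subspace[OF sub]) (simp add: ex_in)
    then show ?thesis by (simp add: ex_eq sum_e)
  qed
  ultimately show "carrier K \<subseteq> ?V" by force
qed

lemma subalg_R_least:
  assumes "subring L K" "linear_subspace K L" "x \<in> L"
  shows "subalg_R \<omega> N \<subseteq> L"
  using assms unfolding subalg_R_def subalgebra_generated_def K_def by blast

lemma linear_subspace_subalg_R: "linear_subspace K (subalg_R \<omega> N)"
proof (rule linear_subspaceI)
  show "subalg_R \<omega> N \<subseteq> carrier K"
    by (rule subalg_R_least[OF carrier_is_subring linear_subspace_carrier x_closed])
qed (auto simp: subalg_R_def subalgebra_generated_def K_def[symmetric] linear_subspaceD)

lemma x_pow_in_subalg_R: "x [^] (n::nat) \<in> subalg_R \<omega> N"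
proof -
  have "x [^] n \<in> L" if L: "subring L K" "x \<in> L" for L
    by (induction n) (use subringE[OF L(1)] L(2) in auto)
  then show ?thesis by (auto simp: subalg_R_def subalgebra_generated_def K_def[symmetric])
qed

text \<open>
  The span of the \<open>e\<^sub>s x\<^sup>n\<close> with \<open>n \<ge> t\<close> is stable under right multiplication by \<open>x\<close>, hence by the
  subalgebra that \<open>x\<close> generates, and it contains \<open>e\<^sub>s x\<^sup>t\<close>. Conversely \<open>e\<^sub>s x\<^sup>n = e\<^sub>s x\<^sup>t x\<^sup>n\<^sup>-\<^sup>t\<close>. The
  case \<open>t \<ge> N\<close> is covered too: the index set is then empty and \<open>e\<^sub>s x\<^sup>t\<close> is zero.
\<close>

lemma N_mod_eq_span: "N_mod \<omega> N s t = lin_span K (case_prod ex ` ({s} \<times> {t..<N}))" (is "_ = ?W")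
proof
  have sub: "linear_subspace K ?W" by (rule linear_subspace_lin_span) auto
  have ex_in: "ex s n \<in> ?W" if "t \<le> n" for n
  proof (cases "n < N")
    case True
    then have "case_prod ex (s, n) \<in> ?W" using that by (intro hull_inc imageI) auto
    then show ?thesis by simp
  next
    case False
    then show ?thesis using linear_subspaceD(2)[OF sub] by (simp add: ex_eq_zero)
  qed
  have "?W \<subseteq> {v \<in> carrier K. v \<otimes> x \<in> ?W}"
  proof (rule hull_minimal)
    have "ex s n \<otimes> x = ex s (Suc n)" for n using ex_mult_x_pow[of s n 1] by simp
    then show "case_prod ex ` ({s} \<times> {t..<N}) \<subseteq> {v \<in> carrier K. v \<otimes> x \<in> ?W}"
      by (auto simp: ex_in)
  qed (auto intro: linear_subspace_preimage[OF sub])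
  then have "subalg_R \<omega> N \<subseteq> {a \<in> carrier K. \<forall>v\<in>?W. v \<otimes> a \<in> ?W}"
    by (intro subalg_R_least stabilizer_subalgebra[OF sub]) (simp_all add: subset_iff)
  then have R: "v \<otimes> r \<in> ?W" if "r \<in> subalg_R \<omega> N" "v \<in> ?W" for r v
    using that by blast
  have N_mod_eq: "N_mod \<omega> N s t = {ex s t \<otimes> r |r. r \<in> subalg_R \<omega> N}"
    by (simp only: N_mod_def K_def)
  show "N_mod \<omega> N s t \<subseteq> ?W"
    unfolding N_mod_eq using R[OF _ ex_in[OF order_refl]] by blast
  show "?W \<subseteq> N_mod \<omega> N s t"
    unfolding N_mod_eq
  proof (rule hull_minimal)
    have "ex s n \<in> {ex s t \<otimes> r |r. r \<in> subalg_R \<omega> N}" if "t \<le> n" for n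
    proof -
      have "ex s n = ex s t \<otimes> x [^] (n - t)" using that by (simp add: ex_mult_x_pow)
      then show ?thesis using x_pow_in_subalg_R by blast
    qed
    then show "case_prod ex ` ({s} \<times> {t..<N}) \<subseteq> {ex s t \<otimes> r |r. r \<in> subalg_R \<omega> N}"
      by (simp add: image_subset_iff)
  qed (rule linear_subspace_image[OF linear_subspace_subalg_R ex_closed])
qed

end

section \<open>Orthogonal complements of the submodules\<close>

theorem theorem14:
  fixes \<omega> \<mu> :: "'s::finite \<Rightarrow> 's"
    and N :: nat
    and \<nu> :: "nat \<Rightarrow> nat"
    and d :: "'s \<Rightarrow> nat \<Rightarrow> 'k::field"
    and B :: "('s gen word \<Rightarrow>\<^sub>0 'k) set \<Rightarrow> ('s gen word \<Rightarrow>\<^sub>0 'k) set \<Rightarrow> 'k"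
    and s :: 's
    and m :: nat
  assumes "N \<ge> 2"
    and "card (UNIV :: 's set) \<ge> N"
    and "bij \<omega>"
    and "bij \<mu>"
    and "bij_betw \<nu> {0..N-1} {0..N-1}"
    and "\<And>t n. n \<le> N - 1 \<Longrightarrow> d t n \<noteq> 0"
    and "bilinear_form (kwN \<omega> N) B"
    and "\<And>t u k n. k \<le> N - 1 \<Longrightarrow> n \<le> N - 1 \<Longrightarrow>
           B (elt_ex \<omega> N t k) (elt_ex \<omega> N u n) = d t k * of_bool (\<mu> t = u) * of_bool (\<nu> k = n)"
    and "m \<le> N - 1"
  shows "perp_R (kwN \<omega> N) B (N_mod \<omega> N s 0) = perp_L (kwN \<omega> N) B (N_mod \<omega> N (\<mu> (\<mu> s)) 0)
    \<and> is_direct_sum (kwN \<omega> N) {t. t \<noteq> \<mu> s} (\<lambda>t. N_mod \<omega> N t 0)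
        (perp_L (kwN \<omega> N) B (N_mod \<omega> N (\<mu> (\<mu> s)) 0))
    \<and> ((\<forall>k\<le>N-1. \<nu> k = N - 1 - k) \<longrightarrow>
          perp_R (kwN \<omega> N) B (N_mod \<omega> N s m) = perp_L (kwN \<omega> N) B (N_mod \<omega> N (\<mu> (\<mu> s)) m)
        \<and> is_direct_sum2 (kwN \<omega> N) (perp_R (kwN \<omega> N) B (N_mod \<omega> N s 0)) (N_mod \<omega> N (\<mu> s) (N - m))
            (perp_R (kwN \<omega> N) B (N_mod \<omega> N s m)))"
proof -
  define K :: "('k, ('s gen word \<Rightarrow>\<^sub>0 'k) set) module" where "K = kwN \<omega> N"
  interpret alg: kwN_algebra \<omega> N K by unfold_locales (rule K_def)
  let ?I = "(UNIV :: 's set) \<times> {..<N}" and ?b = "case_prod (elt_ex \<omega> N)"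
  have less_N: "n < N \<longleftrightarrow> n \<le> N - 1" for n using assms(1) by auto
  have \<nu>: "bij_betw \<nu> {..<N} {..<N}"
    using assms(5) by (simp add: less_N lessThan_def atLeastAtMost_def atLeast_def atMost_def)
  interpret form: monomial_form K ?I ?b "map_prod \<mu> \<nu>" "case_prod d" B
  proof
    show "lin_span K (?b ` ?I) = carrier K"
      using assms(3) by (intro alg.ex_spans) (rule bij_is_surj)
    show "bij_betw (map_prod \<mu> \<nu>) ?I ?I"
      using bij_betw_map_prod[OF assms(4) \<nu>] .
    show "case_prod d i \<noteq> 0" if "i \<in> ?I" for i
      using that assms(6) by (auto simp: less_N)
    show "bilinear_form K B" using assms(7) by (simp add: K_def)
    show "B (?b i) (?b j) = case_prod d i * of_bool (map_prod \<mu> \<nu> i = j)" if "i \<in> ?I" "j \<in> ?I" for i j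
      using that assms(8) by (auto simp: less_N)
  qed auto
  have "inj \<mu>" using assms(4) by (rule bij_is_inj)
  have strip: "{t} \<times> {k..<N} \<subseteq> ?I" for t :: 's and k by auto
  note N_mod = alg.N_mod_eq_span
  have map_strip: "map_prod \<mu> \<nu> ` ({t} \<times> {k..<N}) = {\<mu> t} \<times> \<nu> ` {k..<N}" for t k
    by auto
  \<comment> \<open>Both complements omit only indices with first component \<open>\<mu> s\<close>; which second components they
    omit is all that remains to be compared.\<close>
  have perp_R: "perp_R K B (N_mod \<omega> N s k)
      = lin_span K (?b ` (?I - {\<mu> s} \<times> \<nu> ` {k..<N}))" for k
    using form.perp_R_span[OF strip] by (simp only: N_mod map_strip)
  have perp_L: "perp_L K B (N_mod \<omega> N (\<mu> (\<mu> s)) k)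
      = lin_span K (?b ` (?I - {\<mu> s} \<times> {n \<in> {..<N}. k \<le> \<nu> n}))" for k
  proof -
    have "{i \<in> ?I. map_prod \<mu> \<nu> i \<notin> {\<mu> (\<mu> s)} \<times> {k..<N}}
        = ?I - {\<mu> s} \<times> {n \<in> {..<N}. k \<le> \<nu> n}"
      using \<open>inj \<mu>\<close> \<nu> by (auto simp: inj_eq bij_betw_def)
    then show ?thesis using form.perp_L_span[OF strip] by (simp only: N_mod)
  qed
  have all: "\<nu> ` {0..<N} = {..<N}" "{n \<in> {..<N}. 0 \<le> \<nu> n} = {..<N}"
    using \<nu> by (auto simp: bij_betw_def atLeast0LessThan)
  have eq_0: "perp_R K B (N_mod \<omega> N s 0) = perp_L K B (N_mod \<omega> N (\<mu> (\<mu> s)) 0)"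
    by (simp only: perp_R perp_L all)
  have sum_0: "is_direct_sum K {t. t \<noteq> \<mu> s} (\<lambda>t. N_mod \<omega> N t 0)
      (perp_L K B (N_mod \<omega> N (\<mu> (\<mu> s)) 0))"
  proof -
    have "(\<Union>t\<in>{t. t \<noteq> \<mu> s}. {t} \<times> {0..<N}) = ?I - {\<mu> s} \<times> {..<N}" by auto
    moreover have "is_direct_sum K {t. t \<noteq> \<mu> s} (\<lambda>t. lin_span K (?b ` ({t} \<times> {0..<N})))
        (lin_span K (?b ` (\<Union>t\<in>{t. t \<noteq> \<mu> s}. {t} \<times> {0..<N})))"
      by (rule form.direct_sum_span) (auto simp: disjoint_family_on_def)
    ultimately show ?thesis by (simp only: perp_L all) (simp only: N_mod)
  qed
  have reversal: "perp_R K B (N_mod \<omega> N s m) = perp_L K B (N_mod \<omega> N (\<mu> (\<mu> s)) m)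
      \<and> is_direct_sum2 K (perp_R K B (N_mod \<omega> N s 0)) (N_mod \<omega> N (\<mu> s) (N - m))
          (perp_R K B (N_mod \<omega> N s m))"
    if "\<forall>k\<le>N-1. \<nu> k = N - 1 - k"
  proof -
    have rev: "\<nu> k = N - 1 - k" if "k < N" for k
      using that \<open>\<forall>k\<le>N-1. \<nu> k = N - 1 - k\<close> by (simp add: less_N)
    have im: "\<nu> ` {m..<N} = {..<N - m}"
    proof -
      have "n \<in> \<nu> ` {m..<N}" if "n < N - m" for n
        using that by (intro image_eqI[of _ _ "N - 1 - n"]) (auto simp: rev)
      then show ?thesis by (auto simp: rev)
    qed
    have pre: "{n \<in> {..<N}. m \<le> \<nu> n} = {..<N - m}"
      by (auto simp: rev)
    have "(?I - {\<mu> s} \<times> {..<N}) \<union> {\<mu> s} \<times> {N - m..<N} = ?I - {\<mu> s} \<times> {..<N - m}"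
      by auto
    moreover have "is_direct_sum2 K (lin_span K (?b ` (?I - {\<mu> s} \<times> {..<N})))
        (lin_span K (?b ` ({\<mu> s} \<times> {N - m..<N})))
        (lin_span K (?b ` ((?I - {\<mu> s} \<times> {..<N}) \<union> {\<mu> s} \<times> {N - m..<N})))"
      by (rule form.direct_sum2_span) auto
    ultimately show ?thesis by (simp only: perp_R perp_L all im pre) (simp only: N_mod simp_thms)
  qed
  show ?thesis
    unfolding K_def[symmetric] by (rule conjI[OF eq_0 conjI[OF sum_0 impI[OF reversal]]])
qed

end
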